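(* Let $\rho=\frac{\lambda z_0}{\ell A}$ and suppose that $\frac1\rho\in\mathbb{N}$ and $m\le\frac{\delta}{2}e^{K^2/2}$ for some $\delta>0$ and $K>0$. Then with probability (over the sensor ensemble) greater than $$1-2\delta-\frac{\rho\,n(n-1)^{3/2}}{m^{1/2}},$$ all target vectors $X\in\mathbb C^m$ of sparsity $$s<\frac12\left(1+\frac{\sqrt n}{\sqrt2\,K}\right)$$ can be recovered exactly, by Basis Pursuit as well as by Orthogonal Matching Pursuit, from $Y=\mathbf A X$, where $\mathbf A$ is the source-inversion sensing matrix.
   Context: Fix real numbers $z_0,\ell,A,\lambda>0$ and set $\omega=2\pi/\lambda$. Let $m$ be a perfect square. Target grid: $\mathcal{M}=\{\mathbf r_j=(x_j,y_j,z_0): j=1,\dots,m\}$ is a $\sqrt m\times\sqrt m$ square lattice of mesh size $\ell$ in the plane $\{z=z_0\}$. Sensor ensemble: the sensors are $\mathbf a_q=(\xi_q,\eta_q,0)$, $q=1,\dots,n$, where $(\xi_q,\eta_q)$ are i.i.d. uniformly distributed in $[0,A]\times[0,A]$. Source-inversion sensing matrix: the entries are the paraxial Green function $\frac{e^{i\omega z_0}}{4\pi z_0}e^{i\omega|x-\xi|^2/(2z_0)}e^{i\omega|y-\eta|^2/(2z_0)}$ evaluated at sensor/grid-point pairs, normalized so that columns have unit $\ell^2$-norm; i.e. (up to a constant unimodular factor) $\mathbf A\in\mathbb C^{n\times m}$ has entries $$A_{qj}=\frac{1}{\sqrt n}\exp\!\Big(\tfrac{i\omega}{2z_0}\big[(x_j-\xi_q)^2+(y_j-\eta_q)^2\big]\Big).$$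 The sparsity of $X$ is $s=\|X\|_0$, its number of nonzero entries. Basis Pursuit (BP): given $Y$, solve $\min\|Z\|_1$ subject to $\mathbf A Z=Y$; exact recovery means $X$ is the unique minimizer. Orthogonal Matching Pursuit (OMP): start with residual $Y$ and empty index set; at each step add an index of a column having maximal absolute inner product with the current residual, and replace the residual by $Y$ minus its orthogonal projection onto the span of the selected columns; exact recovery means that after $s$ steps the least-squares coefficients on the selected columns give $X$. *)

theory Defs
  imports "HOL-Probability.Probability"
begin

text \<open>Points of space are triples (x, y, z). The lattice is parallel to the coordinate axes, as
  is the sensor square; its position in the plane and the enumeration of its points are arbitrary.\<close>

definition square_lattice :: "nat \<Rightarrow> real \<Rightarrow> real \<Rightarrow> ('m \<Rightarrow> real \<times> real \<times> real) \<Rightarrow> bool" where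
  "square_lattice N l z0 r \<longleftrightarrow>
    (\<exists>x0 y0. bij_betw r UNIV {(x0 + real a * l, y0 + real b * l, z0) |a b. a < N \<and> b < N})"

definition sensing_matrix ::
  "real \<Rightarrow> real \<Rightarrow> ('m \<Rightarrow> real \<times> real \<times> real) \<Rightarrow> ('n \<Rightarrow> real \<times> real \<times> real) \<Rightarrow> complex ^ 'm ^ 'n" where
  "sensing_matrix \<omega> z0 r a =
    (\<chi> q j. case (r j, a q) of ((x, y, _), (\<xi>, \<eta>, _)) \<Rightarrow>
       complex_of_real (1 / sqrt (real CARD('n))) *
       exp (\<i> * complex_of_real (\<omega> / (2 * z0) * ((x - \<xi>)\<^sup>2 + (y - \<eta>)\<^sup>2))))"

definition support :: "complex ^ 'm \<Rightarrow> 'm set" where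
  "support X = {j. X $ j \<noteq> 0}"

definition sparsity :: "complex ^ 'm \<Rightarrow> nat" where
  "sparsity X = card (support X)"

definition l1_norm :: "complex ^ 'm \<Rightarrow> real" where
  "l1_norm X = (\<Sum>j\<in>UNIV. norm (X $ j))"

definition bp_minimizer :: "complex ^ 'm ^ 'n \<Rightarrow> complex ^ 'n \<Rightarrow> complex ^ 'm \<Rightarrow> bool" where
  "bp_minimizer A Y Z \<longleftrightarrow> A *v Z = Y \<and> (\<forall>W. A *v W = Y \<longrightarrow> l1_norm Z \<le> l1_norm W)"

definition bp_recovers :: "complex ^ 'm ^ 'n \<Rightarrow> complex ^ 'm \<Rightarrow> bool" where
  "bp_recovers A X \<longleftrightarrow> (\<forall>Z. bp_minimizer A (A *v X) Z \<longleftrightarrow> Z = X)"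

text \<open>The library inner product on \<^typ>\<open>complex ^ 'n\<close> is the real one, hence the Hermitian
  product here; \<^const>\<open>vec.span\<close> is the complex span.\<close>

definition hermitian_inner :: "complex ^ 'n \<Rightarrow> complex ^ 'n \<Rightarrow> complex" where
  "hermitian_inner u v = (\<Sum>q\<in>UNIV. cnj (u $ q) * v $ q)"

definition is_orth_proj :: "(complex ^ 'n) set \<Rightarrow> complex ^ 'n \<Rightarrow> complex ^ 'n \<Rightarrow> bool" where
  "is_orth_proj V y p \<longleftrightarrow> p \<in> V \<and> (\<forall>v\<in>V. hermitian_inner v (y - p) = 0)"

text \<open>\<open>omp_state A Y k S R\<close>: after \<open>k\<close> steps the selected index set can be \<open>S\<close>, with residual
  \<open>R\<close>. Ties for the maximal inner product may be broken arbitrarily.\<close>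

inductive omp_state ::
  "complex ^ 'm ^ 'n \<Rightarrow> complex ^ 'n \<Rightarrow> nat \<Rightarrow> 'm set \<Rightarrow> complex ^ 'n \<Rightarrow> bool"
  for A :: "complex ^ 'm ^ 'n" and Y :: "complex ^ 'n" where
  start: "omp_state A Y 0 {} Y"
| step: "omp_state A Y (Suc k) (insert j S) (Y - P)"
    if "omp_state A Y k S R"
      and "\<forall>i. norm (hermitian_inner (column i A) R) \<le> norm (hermitian_inner (column j A) R)"
      and "is_orth_proj (vec.span ((\<lambda>i. column i A) ` insert j S)) Y P"

definition least_squares_on ::
  "complex ^ 'm ^ 'n \<Rightarrow> complex ^ 'n \<Rightarrow> 'm set \<Rightarrow> complex ^ 'm \<Rightarrow> bool" where
  "least_squares_on A Y S Z \<longleftrightarrow>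
    support Z \<subseteq> S \<and> (\<forall>W. support W \<subseteq> S \<longrightarrow> norm (Y - A *v Z) \<le> norm (Y - A *v W))"

text \<open>Success is required for every way of breaking ties; by \<open>omp_state_exists\<close> below the
  quantification over runs is never vacuous.\<close>

definition omp_recovers :: "complex ^ 'm ^ 'n \<Rightarrow> complex ^ 'm \<Rightarrow> bool" where
  "omp_recovers A X \<longleftrightarrow>
    (\<forall>S R. omp_state A (A *v X) (sparsity X) S R \<longrightarrow>
       (\<forall>Z. least_squares_on A (A *v X) S Z \<longleftrightarrow> Z = X))"

lemma hermitian_inner_Re: "Re (hermitian_inner u v) = u \<bullet> v"
  by (simp add: hermitian_inner_def inner_vec_def inner_complex_def)

lemma is_orth_proj_exists: "\<exists>p. is_orth_proj (vec.span B) y p"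
proof -
  have scale: "c *\<^sub>R x = complex_of_real c *s x" for c and x :: "complex ^ 'n"
    unfolding vec_eq_iff vector_scaleR_component vector_smult_component
    by (auto simp: scaleR_conv_of_real[of c "x $ i" for i])
  have "subspace (vec.span B)"
    unfolding subspace_def scale
    by (auto intro: vec.span_zero vec.span_add vec.span_scale)
  then have span: "span (vec.span B) = vec.span B"
    by (simp add: span_eq_iff)
  obtain p z where p: "p \<in> vec.span B" and z: "\<And>w. w \<in> vec.span B \<Longrightarrow> orthogonal z w"
    and y: "y = p + z"
    using orthogonal_subspace_decomp_exists[of "vec.span B" y] unfolding span by metis
  have "hermitian_inner v z = 0" if v: "v \<in> vec.span B" for v
  proof -
    have "Re (hermitian_inner v z) = 0"
      using z[OF v] by (simp add: hermitian_inner_Re orthogonal_def inner_commute)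
    moreover have "Re (hermitian_inner (\<i> *s v) z) = 0"
      using z[OF vec.span_scale[OF v]]
      by (simp add: hermitian_inner_Re orthogonal_def inner_commute)
    moreover have "hermitian_inner (\<i> *s v) z = - \<i> * hermitian_inner v z"
      by (simp add: hermitian_inner_def sum_distrib_left mult.assoc sum_negf)
    ultimately show ?thesis
      by (simp add: complex_eq_iff)
  qed
  with p y show ?thesis
    unfolding is_orth_proj_def by (intro exI[of _ p]) auto
qed

lemma omp_state_exists: "\<exists>S R. omp_state A Y k S R"
proof (induction k)
  case 0
  show ?case by (blast intro: omp_state.start)
next
  case (Suc k)
  then obtain S R where SR: "omp_state A Y k S R" by blast
  let ?f = "\<lambda>i. norm (hermitian_inner (column i A) R)"
  have "Max (range ?f) \<in> range ?f" by (intro Max_in) auto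
  then obtain j where "Max (range ?f) = ?f j" by blast
  then have "\<forall>i. ?f i \<le> ?f j" by (metis Max_ge finite finite_imageI rangeI)
  with SR is_orth_proj_exists show ?case by (blast intro: omp_state.step)
qed

end

theory Submission
  imports Defs
begin

text \<open>Both algorithms succeed on \<open>s\<close>-sparse vectors once the columns are unit vectors whose mutual
  inner products are bounded by \<open>\<mu>\<close> with \<open>(2 * s - 1) * \<mu> < 1\<close>: a kernel vector then has less than
  half of its \<open>\<ell>\<^sup>1\<close> mass on any \<open>s\<close> indices, and the greedy step of OMP never leaves the support.

  The quadratic phases cancel in the inner product of two columns, up to a unimodular factor, and
  leave \<open>1/n\<close> times a sum of independent phases \<open>exp (\<i> * c * (p * \<xi> + p' * \<eta>))\<close>, where
  \<open>(p, p') \<noteq> 0\<close> is the difference of the two lattice points. Since \<open>1/\<rho>\<close> is an integer, each phase has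
  mean zero. Only fewer than \<open>4 * m\<close> differences occur, so Hoeffding's inequality in the six
  normal directions of a hexagon and a union bound give \<open>\<mu> \<le> sqrt 2 * K / sqrt n\<close> outside an
  event of probability less than \<open>2 * \<delta>\<close>.\<close>

section \<open>Recovery from incoherence\<close>

lemma hermitian_inner_matrix_vector_mult:
  "hermitian_inner v (A *v X) = (\<Sum>j\<in>UNIV. hermitian_inner v (column j A) * X $ j)"
proof -
  have "hermitian_inner v (A *v X) = (\<Sum>q\<in>UNIV. \<Sum>j\<in>UNIV. cnj (v $ q) * A $ q $ j * X $ j)"
    by (simp add: hermitian_inner_def matrix_vector_mult_def sum_distrib_left mult.assoc)
  also have "\<dots> = (\<Sum>j\<in>UNIV. \<Sum>q\<in>UNIV. cnj (v $ q) * A $ q $ j * X $ j)"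
    by (rule sum.swap)
  also have "\<dots> = (\<Sum>j\<in>UNIV. hermitian_inner v (column j A) * X $ j)"
    by (simp add: hermitian_inner_def column_def sum_distrib_right)
  finally show ?thesis .
qed

lemma hermitian_inner_zero_right [simp]: "hermitian_inner v 0 = 0"
  by (simp add: hermitian_inner_def)

lemma column_eq_matrix_vector_mult:
  fixes A :: "complex ^ 'm ^ 'n"
  shows "column i A = A *v axis i 1"
  by (simp add: vec_eq_iff column_def matrix_vector_mult_def axis_def if_distrib cong: if_cong)

text \<open>Turns a projection onto selected columns into the image of a vector supported there, so
  that OMP residuals take the form \<open>A *v (X - V)\<close>.\<close>

lemma span_columns_subset:
  fixes A :: "complex ^ 'm ^ 'n"
  shows "vec.span ((\<lambda>i. column i A) ` S) \<subseteq> {A *v W |W. support W \<subseteq> S}"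
proof (rule vec.span_minimal)
  show "(\<lambda>i. column i A) ` S \<subseteq> {A *v W |W. support W \<subseteq> S}"
  proof (rule image_subsetI)
    fix i assume "i \<in> S"
    then show "column i A \<in> {A *v W |W. support W \<subseteq> S}"
      by (intro CollectI exI[of _ "axis i 1"])
        (simp add: column_eq_matrix_vector_mult, simp add: support_def axis_def)
  qed
  have support_add: "support (V + W) \<subseteq> support V \<union> support W" for V W :: "complex ^ 'm"
    by (auto simp: support_def)
  show "vec.subspace {A *v W |W. support W \<subseteq> S}"
  proof (rule vec.subspaceI)
    show "0 \<in> {A *v W |W. support W \<subseteq> S}"
      by (intro CollectI exI[of _ 0]) (simp add: support_def)
  next
    fix x y assume "x \<in> {A *v W |W. support W \<subseteq> S}" "y \<in> {A *v W |W. support W \<subseteq> S}"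
    then obtain V W where VW: "x = A *v V" "support V \<subseteq> S" "y = A *v W" "support W \<subseteq> S"
      by auto
    then have "support (V + W) \<subseteq> S"
      using order_trans[OF support_add[of V W] Un_least] by simp
    with VW show "x + y \<in> {A *v W |W. support W \<subseteq> S}"
      by (intro CollectI exI[of _ "V + W"]) (simp add: matrix_vector_right_distrib)
  next
    fix c x assume "x \<in> {A *v W |W. support W \<subseteq> S}"
    then obtain W where W: "x = A *v W" "support W \<subseteq> S"
      by auto
    moreover have "support (c *s W) \<subseteq> support W"
      by (auto simp: support_def)
    ultimately show "c *s x \<in> {A *v W |W. support W \<subseteq> S}"
      by (intro CollectI exI[of _ "c *s W"]) (simp add: vector_scalar_commute)
  qed
qed

lemma l1_norm_eq_0_iff [simp]: "l1_norm X = 0 \<longleftrightarrow> X = 0"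
  by (simp add: l1_norm_def sum_nonneg_eq_0_iff vec_eq_iff)

lemma l1_norm_nonneg [simp]: "0 \<le> l1_norm X"
  by (simp add: l1_norm_def sum_nonneg)

text \<open>\<open>\<mu>\<close> is any positive bound on the mutual coherence rather than the
  coherence itself, so a bound that holds with high probability can be inserted.\<close>

locale incoherent =
  fixes A :: "complex ^ 'm ^ 'n" and \<mu> :: real
  assumes mu_pos: "\<mu> > 0"
    and unit: "hermitian_inner (column j A) (column j A) = 1"
    and coherence: "i \<noteq> j \<Longrightarrow> norm (hermitian_inner (column i A) (column j A)) \<le> \<mu>"
begin

section \<open>Null space property and Basis Pursuit\<close>

lemma inner_column_split:
  "hermitian_inner (column i A) (A *v h) =
     h $ i + (\<Sum>j\<in>UNIV - {i}. hermitian_inner (column i A) (column j A) * h $ j)"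
  unfolding hermitian_inner_matrix_vector_mult
  by (subst sum.remove[of _ i]) (auto simp: unit)

lemma norm_off_diagonal_le:
  "norm (\<Sum>j\<in>B - {i}. hermitian_inner (column i A) (column j A) * h $ j)
     \<le> \<mu> * (\<Sum>j\<in>B - {i}. norm (h $ j))"
proof -
  have "norm (\<Sum>j\<in>B - {i}. hermitian_inner (column i A) (column j A) * h $ j)
      \<le> (\<Sum>j\<in>B - {i}. \<mu> * norm (h $ j))"
    by (rule sum_norm_le) (auto simp: norm_mult intro!: mult_right_mono coherence)
  then show ?thesis by (simp add: sum_distrib_left)
qed

text \<open>Pairing \<open>A *v h = 0\<close> with column \<open>i\<close> writes
  \<open>h $ i\<close> as minus a combination of the other entries, with weights of modulus at most
  \<open>\<mu>\<close>; adding \<open>\<mu> * norm (h $ i)\<close> to both sides completes the l1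
  norm.\<close>

lemma kernel_entry_le:
  assumes "A *v h = 0"
  shows "(1 + \<mu>) * norm (h $ i) \<le> \<mu> * l1_norm h"
proof -
  have "h $ i = - (\<Sum>j\<in>UNIV - {i}. hermitian_inner (column i A) (column j A) * h $ j)"
    using inner_column_split[of i h] assms by (simp add: eq_neg_iff_add_eq_0)
  from arg_cong[OF this, of norm]
  have "norm (h $ i) \<le> \<mu> * (\<Sum>j\<in>UNIV - {i}. norm (h $ j))"
    unfolding norm_minus_cancel using norm_off_diagonal_le[of i h UNIV] by (rule ord_eq_le_trans)
  also have "(\<Sum>j\<in>UNIV - {i}. norm (h $ j)) = l1_norm h - norm (h $ i)"
    unfolding l1_norm_def by (subst sum.remove[of UNIV i]) auto
  finally show ?thesis by (simp add: algebra_simps)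
qed

text \<open>Sum the entrywise bound over \<open>T\<close>; the hypothesis says
  \<open>2 * card T * \<mu> < 1 + \<mu>\<close>.\<close>

lemma null_space_property:
  assumes "A *v h = 0" "h \<noteq> 0" and T: "(2 * real (card T) - 1) * \<mu> < 1"
  shows "2 * (\<Sum>j\<in>T. norm (h $ j)) < l1_norm h"
proof -
  have pos: "l1_norm h > 0"
    using assms(2) l1_norm_nonneg[of h] l1_norm_eq_0_iff[of h] by linarith
  have "(1 + \<mu>) * (\<Sum>j\<in>T. norm (h $ j)) \<le> (\<Sum>j\<in>T. \<mu> * l1_norm h)"
    unfolding sum_distrib_left by (intro sum_mono kernel_entry_le assms)
  then have "(1 + \<mu>) * (2 * (\<Sum>j\<in>T. norm (h $ j))) \<le> (2 * real (card T) * \<mu>) * l1_norm h"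
    by (simp add: algebra_simps)
  also have "\<dots> < (1 + \<mu>) * l1_norm h"
    using T pos by (intro mult_strict_right_mono) (auto simp: algebra_simps)
  finally show ?thesis using mu_pos by simp
qed

text \<open>Adding a kernel vector \<open>h\<close> to \<open>X\<close> lowers the l1 norm on the
  support by at most the mass of \<open>h\<close> there and raises it off the support by the mass of
  \<open>h\<close> there, which is larger.\<close>

lemma bp_recovers_sparse:
  assumes s: "(2 * real (sparsity X) - 1) * \<mu> < 1"
  shows "bp_recovers A X"
proof -
  have less: "l1_norm X < l1_norm W" if W: "A *v W = A *v X" "W \<noteq> X" for W
  proof -
    define h where "h = W - X"
    have h: "A *v h = 0" "h \<noteq> 0"
      using W by (auto simp: h_def matrix_vector_mult_diff_distrib)
    let ?T = "support X"
    have split: "l1_norm V = (\<Sum>j\<in>?T. norm (V $ j)) + (\<Sum>j\<in>-?T. norm (V $ j))"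
      for V :: "complex ^ 'm"
      unfolding l1_norm_def
      by (subst sum.union_disjoint[symmetric]) auto
    have "2 * (\<Sum>j\<in>?T. norm (h $ j)) < l1_norm h"
      using null_space_property[OF h] s by (simp add: sparsity_def)
    then have "(\<Sum>j\<in>?T. norm (h $ j)) < (\<Sum>j\<in>-?T. norm (h $ j))"
      using split[of h] by simp
    moreover have "(\<Sum>j\<in>-?T. norm (W $ j)) = (\<Sum>j\<in>-?T. norm (h $ j))"
      by (rule sum.cong) (auto simp: h_def support_def)
    moreover have "l1_norm X = (\<Sum>j\<in>?T. norm (X $ j))"
      unfolding split[of X] by (simp add: support_def)
    moreover have "(\<Sum>j\<in>?T. norm (X $ j)) \<le> (\<Sum>j\<in>?T. norm (W $ j)) + (\<Sum>j\<in>?T. norm (h $ j))"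
      unfolding sum.distrib[symmetric]
      by (rule sum_mono) (metis h_def norm_minus_commute norm_triangle_sub vector_minus_component)
    ultimately show ?thesis using split[of W] by linarith
  qed
  show ?thesis
    unfolding bp_recovers_def bp_minimizer_def
    using less by (metis less_le_not_le order_refl)
qed

section \<open>Orthogonal Matching Pursuit\<close>

text \<open>\<open>D\<close> is the part of the signal not yet explained. If \<open>M\<close> is its
  largest modulus, attained at \<open>k\<close>, the correlation at \<open>k\<close> is at least
  \<open>M - \<mu> * (card T - 1) * M\<close>, while off \<open>T\<close> it is at most
  \<open>\<mu> * card T * M\<close>; the hypothesis separates the two values.\<close>

lemma greedy_choice_in_support:
  assumes T: "support D \<subseteq> T" "(2 * real (card T) - 1) * \<mu> < 1" and D: "D \<noteq> 0"
    and j: "\<forall>i. norm (hermitian_inner (column i A) (A *v D))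
              \<le> norm (hermitian_inner (column j A) (A *v D))"
  shows "j \<in> T" "hermitian_inner (column j A) (A *v D) \<noteq> 0"
proof -
  define M where "M = Max (range (\<lambda>i. norm (D $ i)))"
  have M: "norm (D $ i) \<le> M" for i
    unfolding M_def by (intro Max_ge) auto
  have "M \<in> range (\<lambda>i. norm (D $ i))"
    unfolding M_def by (intro Max_in) auto
  then obtain k where k: "norm (D $ k) = M" by auto
  have "M > 0"
    using D M by (metis norm_le_zero_iff not_less order_trans vec_eq_iff zero_index)
  with k have kT: "k \<in> T" using T(1) by (auto simp: support_def)
  have off: "D $ i = 0" if "i \<notin> T" for i
    using T(1) that by (auto simp: support_def)
  have split: "hermitian_inner (column i A) (A *v D) =
      D $ i + (\<Sum>j\<in>T - {i}. hermitian_inner (column i A) (column j A) * D $ j)" for i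
    unfolding inner_column_split
    by (rule arg_cong[of _ _ "\<lambda>x. D $ i + x"], rule sum.mono_neutral_right)
      (use T(1) in \<open>auto simp: support_def\<close>)
  have bound: "norm (\<Sum>j\<in>T - {i}. hermitian_inner (column i A) (column j A) * D $ j)
      \<le> \<mu> * (real (card (T - {i})) * M)" for i
  proof -
    have "(\<Sum>j\<in>T - {i}. norm (D $ j)) \<le> real (card (T - {i})) * M"
      using M by (intro sum_bounded_above) auto
    with mu_pos norm_off_diagonal_le[of i D T] show ?thesis
      by (meson mult_left_mono less_imp_le order_trans)
  qed
  have "card T > 0" using kT by (auto simp: card_gt_0_iff)
  then have "real (card (T - {k})) = real (card T) - 1"
    using kT by (simp add: card_Diff_singleton of_nat_diff)
  then have low: "norm (hermitian_inner (column k A) (A *v D)) \<ge> M - \<mu> * ((real (card T) - 1) * M)"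
    unfolding split using bound[of k] k
    by (smt (verit) norm_diff_ineq)
  have gap: "\<mu> * (real (card T) * M) < M - \<mu> * ((real (card T) - 1) * M)"
    using mult_strict_right_mono[OF T(2) \<open>M > 0\<close>] by (simp add: algebra_simps)
  show "j \<in> T"
  proof (rule ccontr)
    assume "j \<notin> T"
    then have "norm (hermitian_inner (column j A) (A *v D)) \<le> \<mu> * (real (card T) * M)"
      using bound[of j] by (simp add: split[of j] off)
    with low gap j[rule_format, of k] show False by linarith
  qed
  have "0 \<le> \<mu> * (real (card T) * M)" using mu_pos \<open>M > 0\<close> by simp
  with low gap j[rule_format, of k] show "hermitian_inner (column j A) (A *v D) \<noteq> 0"
    by auto
qed

text \<open>The residual is always the image of a vector supported in \<open>support X\<close>, so
  the greedy lemma applies at each step. Its orthogonality to the selected columns forces every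
  choice to be new, which gives \<open>card S = k\<close>.\<close>

lemma omp_state_invariant:
  assumes "omp_state A (A *v X) k S R" "k \<le> sparsity X"
    and s: "(2 * real (sparsity X) - 1) * \<mu> < 1"
  shows "S \<subseteq> support X \<and> card S = k \<and>
    (\<exists>V. support V \<subseteq> S \<and> R = A *v (X - V)) \<and> (\<forall>i\<in>S. hermitian_inner (column i A) R = 0)"
  using assms(1,2)
proof (induction rule: omp_state.induct)
  case start
  show ?case
    by (auto simp: support_def intro!: exI[of _ 0])
next
  case (step k S R j P)
  then obtain V where S: "S \<subseteq> support X" "card S = k" and V: "support V \<subseteq> S" "R = A *v (X - V)"
    and orth: "\<forall>i\<in>S. hermitian_inner (column i A) R = 0"
    by auto
  \<comment> \<open>Fewer than \<open>sparsity X\<close> indices have been selected, so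
    \<open>S\<close> cannot contain the whole support.\<close>
  have "X - V \<noteq> 0"
  proof
    assume "X - V = 0"
    then have "support X \<subseteq> S" using V by simp
    then have "sparsity X \<le> k" using S by (metis sparsity_def card_mono finite)
    with step.prems show False by simp
  qed
  moreover have "support (X - V) \<subseteq> support X"
    using V(1) S(1) by (auto simp: support_def)
  ultimately have j: "j \<in> support X" "hermitian_inner (column j A) R \<noteq> 0"
    using greedy_choice_in_support[of "X - V" "support X" j] s step.hyps(2) V(2)
    by (auto simp: sparsity_def)
  have P: "P \<in> vec.span ((\<lambda>i. column i A) ` insert j S)"
    and orthP: "\<And>v. v \<in> vec.span ((\<lambda>i. column i A) ` insert j S) \<Longrightarrow>
                  hermitian_inner v (A *v X - P) = 0"
    using step.hyps(3) by (auto simp: is_orth_proj_def)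
  obtain W where W: "support W \<subseteq> insert j S" "P = A *v W"
    using P span_columns_subset[of A "insert j S"] by blast
  have "j \<notin> S" using j orth by blast
  with S j W orthP show ?case
    by (auto simp: matrix_vector_mult_diff_distrib intro!: vec.span_base)
qed

text \<open>After \<open>sparsity X\<close> distinct choices inside the support, \<open>S\<close> is
  the support. The data are attained exactly, so a least-squares solution has zero residual, and
  injectivity on \<open>S\<close> identifies it.\<close>

lemma omp_recovers_sparse:
  assumes s: "(2 * real (sparsity X) - 1) * \<mu> < 1"
  shows "omp_recovers A X"
  unfolding omp_recovers_def
proof (intro allI impI)
  fix S R Z assume "omp_state A (A *v X) (sparsity X) S R"
  then have "S \<subseteq> support X" "card S = sparsity X"
    using omp_state_invariant[OF _ order_refl s] by blast+
  then have S: "S = support X"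
    by (simp add: card_subset_eq sparsity_def)
  \<comment> \<open>A nonzero kernel vector supported on \<open>S\<close> would have all its mass
    there, against the bound of less than half.\<close>
  have inj: "Z = X" if "support Z \<subseteq> S" "A *v Z = A *v X"
  proof (rule ccontr)
    assume "Z \<noteq> X"
    then have h: "A *v (Z - X) = 0" "Z - X \<noteq> 0"
      using that by (auto simp: matrix_vector_mult_diff_distrib)
    have "l1_norm (Z - X) = (\<Sum>j\<in>S. norm ((Z - X) $ j))"
      unfolding l1_norm_def
      by (rule sum.mono_neutral_right) (use that(1) S in \<open>auto simp: support_def\<close>)
    with null_space_property[OF h, of S] s S l1_norm_nonneg[of "Z - X"] show False
      by (simp add: sparsity_def)
  qed
  show "least_squares_on A (A *v X) S Z \<longleftrightarrow> Z = X"
  proof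
    assume Z: "least_squares_on A (A *v X) S Z"
    then have "norm (A *v X - A *v Z) \<le> norm (A *v X - A *v X)"
      using S unfolding least_squares_on_def by blast
    with Z inj show "Z = X" by (auto simp: least_squares_on_def)
  next
    assume "Z = X"
    then show "least_squares_on A (A *v X) S Z"
      using S by (auto simp: least_squares_on_def)
  qed
qed

end

section \<open>Concentration of phase sums\<close>

lemma integral_cos_full_periods:
  assumes "A > 0" "k * A = 2 * pi * of_int i" "i \<noteq> 0"
  shows "(\<integral>x. indicator {0..A} x *\<^sub>R cos (k * x + \<beta>) \<partial>lborel) = 0"
proof -
  have k: "k \<noteq> 0" using assms by auto
  have "(\<integral>x. indicator {0..A} x *\<^sub>R cos (k * x + \<beta>) \<partial>lborel)
      = sin (k * A + \<beta>) / k - sin (k * 0 + \<beta>) / k"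
  proof (rule integral_FTC_Icc)
    show "((\<lambda>x. sin (k * x + \<beta>) / k) has_vector_derivative cos (k * x + \<beta>)) (at x within {0..A})" for x
      unfolding has_real_derivative_iff_has_vector_derivative[symmetric]
      by (rule derivative_eq_intros refl | simp add: k)+
  qed (use assms in \<open>auto intro!: continuous_intros\<close>)
  also have "sin (k * A + \<beta>) = sin \<beta>"
    unfolding assms(2) by (simp add: sin_add sin_int_2pin cos_int_2pin)
  finally show ?thesis by simp
qed

text \<open>By Fubini, integrate first in a coordinate with nonzero frequency; the inner integral
  runs over full periods.\<close>

lemma uniform_square_integral_cos:
  assumes A: "A > 0" and ab: "a * A = 2 * pi * of_int i" "b * A = 2 * pi * of_int j"
    and nz: "i \<noteq> 0 \<or> j \<noteq> 0"
  shows "(\<integral>z. cos (a * fst z + b * snd z + \<beta>) \<partial>uniform_measure lborel ({0..A} \<times> {0..A})) = 0"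
proof -
  let ?Q = "{0..A} \<times> {0..A}"
  \<comment> \<open>Separate indicators allow either order of integration, the other indicator being
    a constant factor.\<close>
  define g where "g = (\<lambda>x y. indicator {0..A} x *\<^sub>R (indicator {0..A} y *\<^sub>R cos (a * x + b * y + \<beta>)))"
  have g: "case_prod g = (\<lambda>z. indicator ?Q z *\<^sub>R cos (a * fst z + b * snd z + \<beta>))"
    by (auto simp: g_def indicator_def fun_eq_iff)
  have "integrable lborel (case_prod g)"
    unfolding g
    by (intro borel_integrable_compact compact_Times) (auto intro!: continuous_intros)
  then have int: "integrable (lborel \<Otimes>\<^sub>M lborel) (case_prod g)"
    by (simp add: lborel_prod)
  have zero: "integral\<^sup>L lborel (case_prod g) = 0"
    using nz
  proof
    assume "i \<noteq> 0"
    have "(\<integral>x. g x y \<partial>lborel) = 0" for y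
    proof -
      have "(\<integral>x. g x y \<partial>lborel) =
          indicator {0..A} y *\<^sub>R (\<integral>x. indicator {0..A} x *\<^sub>R cos (a * x + (b * y + \<beta>)) \<partial>lborel)"
        unfolding g_def integral_scaleR_right[symmetric]
        by (simp add: ac_simps)
      then show ?thesis
        by (simp only: integral_cos_full_periods[OF A ab(1) \<open>i \<noteq> 0\<close>] scaleR_zero_right)
    qed
    then show ?thesis
      using lborel_pair.integral_snd[OF int] by (simp add: lborel_prod)
  next
    assume "j \<noteq> 0"
    have "(\<integral>y. g x y \<partial>lborel) = 0" for x
    proof -
      have "(\<integral>y. g x y \<partial>lborel) =
          indicator {0..A} x *\<^sub>R (\<integral>y. indicator {0..A} y *\<^sub>R cos (b * y + (a * x + \<beta>)) \<partial>lborel)"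
        unfolding g_def integral_scaleR_right[symmetric]
        by (simp add: ac_simps)
      then show ?thesis
        by (simp only: integral_cos_full_periods[OF A ab(2) \<open>j \<noteq> 0\<close>] scaleR_zero_right)
    qed
    then show ?thesis
      using lborel_pair.integral_fst[OF int] by (simp add: lborel_prod)
  qed
  \<comment> \<open>Normalization by the area reduces the claim to the Lebesgue integral just shown
    to vanish.\<close>
  have "emeasure lborel ?Q = ennreal (A * A)"
    using A lborel.emeasure_pair_measure_Times[of "{0..A}" lborel "{0..A}"]
    by (simp add: lborel_prod ennreal_mult)
  moreover have "indicator ?Q z / ennreal (A * A) = ennreal (indicator ?Q z / (A * A))" for z
    using A divide_ennreal[of 1 "A * A"] by (cases "z \<in> ?Q") auto
  ultimately have "uniform_measure lborel ?Q = density lborel (\<lambda>z. ennreal (indicator ?Q z / (A * A)))"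
    unfolding uniform_measure_def by (simp only:)
  then have "(\<integral>z. cos (a * fst z + b * snd z + \<beta>) \<partial>uniform_measure lborel ?Q)
      = (\<integral>z. (indicator ?Q z / (A * A)) *\<^sub>R cos (a * fst z + b * snd z + \<beta>) \<partial>lborel)"
  proof (simp only:, intro integral_density)
    show "(\<lambda>z. cos (a * fst z + b * snd z + \<beta>)) \<in> borel_measurable lborel"
      unfolding measurable_lborel2 by (intro borel_measurable_continuous_onI continuous_intros)
    show "(\<lambda>z. indicator ?Q z / (A * A)) \<in> borel_measurable lborel"
      unfolding measurable_lborel2
      by (intro borel_measurable_divide borel_measurable_indicator borel_closed closed_Times) auto
    show "AE z in lborel. 0 \<le> indicator ?Q z / (A * A)"
      using A by (intro AE_I2) (simp add: indicator_def)
  qed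
  also have "\<dots> = (\<integral>z. (1 / (A * A)) * case_prod g z \<partial>lborel)"
    unfolding g by (rule Bochner_Integration.integral_cong) auto
  also have "\<dots> = 0"
    by (simp only: integral_mult_right_zero zero)
  finally show ?thesis .
qed

section \<open>Hexagonal approximation of the disc and tail bounds\<close>

text \<open>The conditions cut out the open regular hexagon whose vertices are \<open>t\<close>
  times the sixth roots of unity; its sides have distance \<open>t * sqrt 3 / 2\<close> from the
  origin.\<close>

lemma norm_less_if_in_hexagon:
  assumes "\<bar>Im z\<bar> < t * (sqrt 3 / 2)" "\<bar>Re z\<bar> * sqrt 3 + \<bar>Im z\<bar> < t * sqrt 3"
  shows "norm z < t"
proof -
  \<comment> \<open>On a slanted side \<open>\<bar>Re z\<bar> = t - b\<close>, with \<open>b\<close>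
    running from \<open>0\<close> to \<open>t / 2\<close>; the defect
    \<open>2 * b * (t - 2 * b)\<close> vanishes at the two vertices.\<close>
  define b where "b = \<bar>Im z\<bar> / sqrt 3"
  have Im: "\<bar>Im z\<bar> = b * sqrt 3" by (simp add: b_def)
  have b: "0 \<le> b" "2 * b < t"
    using assms(1) by (simp_all add: b_def field_simps)
  have "(\<bar>Re z\<bar> + b) * sqrt 3 < t * sqrt 3"
    using assms(2) unfolding Im by (simp add: algebra_simps)
  then have "\<bar>Re z\<bar> < t - b" by simp
  then have "\<bar>Re z\<bar>\<^sup>2 < (t - b)\<^sup>2" by (intro power_strict_mono) auto
  moreover have "\<bar>Im z\<bar>\<^sup>2 = 3 * b\<^sup>2" unfolding Im by (simp add: power_mult_distrib)
  ultimately have "(norm z)\<^sup>2 < (t - b)\<^sup>2 + 3 * b\<^sup>2"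
    by (simp add: cmod_power2)
  also have "\<dots> = t\<^sup>2 - 2 * b * (t - 2 * b)"
    by (simp add: power2_eq_square algebra_simps)
  also have "\<dots> \<le> t\<^sup>2" using b by simp
  finally have "(norm z)\<^sup>2 < t\<^sup>2" .
  moreover have "0 \<le> t" using b by linarith
  ultimately show ?thesis by (rule power2_less_imp_less)
qed

lemma (in prob_space) uniform_phase_sum_tail:
  fixes \<xi> \<eta> :: "'n::finite \<Rightarrow> 'a \<Rightarrow> real"
  assumes indep: "indep_vars (\<lambda>_. borel) (\<lambda>q w. (\<xi> q w, \<eta> q w)) UNIV"
    and unif: "\<And>q. distr M borel (\<lambda>w. (\<xi> q w, \<eta> q w)) =
                    uniform_measure lborel ({0..A} \<times> {0..A})"
    and A: "A > 0" and ab: "a * A = 2 * pi * of_int i" "b * A = 2 * pi * of_int j"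
    and nz: "i \<noteq> 0 \<or> j \<noteq> 0" and \<epsilon>: "\<epsilon> \<ge> 0"
  shows "prob {w \<in> space M. (\<Sum>q\<in>UNIV. cos (a * \<xi> q w + b * \<eta> q w + \<beta>)) \<ge> \<epsilon>}
    \<le> exp (- \<epsilon>\<^sup>2 / (2 * real CARD('n)))"
proof -
  define f where "f = (\<lambda>z::real \<times> real. cos (a * fst z + b * snd z + \<beta>))"
  have f: "f \<in> borel_measurable borel"
    unfolding f_def by (intro borel_measurable_continuous_onI continuous_intros)
  define X where "X = (\<lambda>q w. f (\<xi> q w, \<eta> q w))"
  have rv: "(\<lambda>w. (\<xi> q w, \<eta> q w)) \<in> borel_measurable M" for q
    using indep by (simp add: indep_vars_def)
  have E0: "expectation (X q) = 0" for q
  proof -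
    have "expectation (X q) = integral\<^sup>L (distr M borel (\<lambda>w. (\<xi> q w, \<eta> q w))) f"
      unfolding X_def by (rule integral_distr[symmetric, OF rv f])
    also have "\<dots> = 0"
      unfolding unif f_def by (rule uniform_square_integral_cos[OF A ab nz])
    finally show ?thesis .
  qed
  have X_indep: "indep_vars (\<lambda>_. borel) X UNIV"
    unfolding X_def by (rule indep_vars_compose2[OF indep]) (rule f)
  \<comment> \<open>Each cosine ranges over an interval of length 2, so the squared lengths add up
    to \<open>4 * CARD('n)\<close>.\<close>
  interpret Hoeffding_ineq M UNIV X "\<lambda>_. -1" "\<lambda>_. 1" 0
  proof unfold_locales
    show "AE w in M. X q w \<in> {-1..1}" for q
      by (simp add: X_def f_def)
  qed (use X_indep in \<open>simp_all add: E0\<close>)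
  show ?thesis
    using Hoeffding_ineq_ge[OF \<epsilon>] by (simp add: X_def f_def)
qed

text \<open>Three angles suffice: replacing \<open>\<theta>\<close> by \<open>- \<theta>\<close> conjugates the sum, which supplies the
  remaining three normal directions of the hexagon.\<close>

lemma norm_sum_cis_less_if_three_directions:
  fixes \<theta> :: "'n::finite \<Rightarrow> real"
  assumes pos: "\<And>\<beta>. \<beta> \<in> {- (pi / 6), - (pi / 2), pi / 6 + pi} \<Longrightarrow>
              (\<Sum>q\<in>UNIV. cos (\<theta> q + \<beta>)) < t * (sqrt 3 / 2)"
    and neg: "\<And>\<beta>. \<beta> \<in> {- (pi / 6), - (pi / 2), pi / 6 + pi} \<Longrightarrow>
              (\<Sum>q\<in>UNIV. cos (- \<theta> q + \<beta>)) < t * (sqrt 3 / 2)"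
  shows "norm (\<Sum>q\<in>UNIV. cis (\<theta> q)) < t"
proof (rule norm_less_if_in_hexagon)
  define C where "C = (\<Sum>q\<in>UNIV. cos (\<theta> q))"
  define S where "S = (\<Sum>q\<in>UNIV. sin (\<theta> q))"
  have Re: "Re (\<Sum>q\<in>UNIV. cis (\<theta> q)) = C" and Im: "Im (\<Sum>q\<in>UNIV. cis (\<theta> q)) = S"
    by (simp_all add: C_def S_def)
  have eq: "(\<Sum>q\<in>UNIV. cos (\<theta> q + \<beta>)) = C * cos \<beta> - S * sin \<beta>"
    "(\<Sum>q\<in>UNIV. cos (- \<theta> q + \<beta>)) = C * cos \<beta> + S * sin \<beta>" for \<beta>
    by (simp_all only: cos_add cos_minus sin_minus mult_minus_left diff_minus_eq_add
        sum_subtractf sum.distrib sum_distrib_right C_def S_def)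
  have "C * (sqrt 3 / 2) + S * (1 / 2) < t * (sqrt 3 / 2)"
    "C * (sqrt 3 / 2) - S * (1 / 2) < t * (sqrt 3 / 2)"
    using pos[of "- (pi / 6)"] neg[of "- (pi / 6)"] unfolding eq by (simp_all add: cos_30 sin_30)
  moreover have S: "S < t * (sqrt 3 / 2)" "- S < t * (sqrt 3 / 2)"
    using pos[of "- (pi / 2)"] neg[of "- (pi / 2)"] unfolding eq by simp_all
  moreover have "- (C * (sqrt 3 / 2)) + S * (1 / 2) < t * (sqrt 3 / 2)"
    "- (C * (sqrt 3 / 2)) - S * (1 / 2) < t * (sqrt 3 / 2)"
    using pos[of "pi / 6 + pi"] neg[of "pi / 6 + pi"]
    unfolding eq cos_periodic_pi sin_periodic_pi cos_30 sin_30 by simp_all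
  ultimately have "\<bar>C * sqrt 3\<bar> + \<bar>S\<bar> < t * sqrt 3"
    by linarith
  then show "\<bar>Re (\<Sum>q\<in>UNIV. cis (\<theta> q))\<bar> * sqrt 3 + \<bar>Im (\<Sum>q\<in>UNIV. cis (\<theta> q))\<bar> < t * sqrt 3"
    unfolding Re Im by (simp add: abs_mult)
  show "\<bar>Im (\<Sum>q\<in>UNIV. cis (\<theta> q))\<bar> < t * (sqrt 3 / 2)"
    unfolding Im using S by linarith
qed

text \<open>The conjugate of a sum belongs to the opposite pair, so with \<open>D\<close> closed
  under negation three events per pair cover all six directions. The inradius
  \<open>t * sqrt 3 / 2\<close> as deviation yields the exponent
  \<open>3 * t\<^sup>2 / (8 * CARD('n))\<close>, up to sign.\<close>

lemma (in prob_space) uniform_phase_sums_bounded: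
  fixes \<xi> \<eta> :: "'n::finite \<Rightarrow> 'a \<Rightarrow> real" and D :: "(int \<times> int) set"
  assumes indep: "indep_vars (\<lambda>_. borel) (\<lambda>q w. (\<xi> q w, \<eta> q w)) UNIV"
    and unif: "\<And>q. distr M borel (\<lambda>w. (\<xi> q w, \<eta> q w)) =
                    uniform_measure lborel ({0..A} \<times> {0..A})"
    and A: "A > 0" and c: "c * A = 2 * pi * of_int k" "k \<noteq> 0" and t: "t \<ge> 0"
    and D: "finite D" "(0, 0) \<notin> D" "\<And>p p'. (p, p') \<in> D \<Longrightarrow> (- p, - p') \<in> D"
  shows "\<exists>E\<in>events. prob E \<ge> 1 - 3 * real (card D) * exp (- (3 * t\<^sup>2) / (8 * real CARD('n))) \<and>
    (\<forall>w\<in>E. \<forall>(p, p')\<in>D.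
       norm (\<Sum>q\<in>UNIV. cis (c * of_int p * \<xi> q w + c * of_int p' * \<eta> q w)) < t)"
proof -
  define B where "B = {- (pi / 6), - (pi / 2), pi / 6 + pi}"
  define F where "F = (\<lambda>((p, p'), \<beta>). {w \<in> space M.
    (\<Sum>q\<in>UNIV. cos (c * of_int p * \<xi> q w + c * of_int p' * \<eta> q w + \<beta>)) \<ge> t * (sqrt 3 / 2)})"
  define E where "E = space M - (\<Union>x\<in>D \<times> B. F x)"
  have rv: "(\<lambda>w. (\<xi> q w, \<eta> q w)) \<in> borel_measurable M" for q
    using indep by (simp add: indep_vars_def)
  have "(\<lambda>w. fst (\<xi> q w, \<eta> q w)) \<in> borel_measurable M" "(\<lambda>w. snd (\<xi> q w, \<eta> q w)) \<in> borel_measurable M" for q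
    by (rule measurable_compose[OF rv], intro borel_measurable_continuous_onI continuous_intros)+
  then have [measurable]: "\<xi> q \<in> borel_measurable M" "\<eta> q \<in> borel_measurable M" for q
    by simp_all
  have F: "F x \<in> events" for x
    unfolding F_def by (cases x) (auto simp: split_beta)
  have prob_F: "prob (F x) \<le> exp (- (3 * t\<^sup>2) / (8 * real CARD('n)))" if x: "x \<in> D \<times> B" for x
  proof -
    obtain p p' \<beta> where xeq: "x = ((p, p'), \<beta>)" by (cases x) auto
    \<comment> \<open>The integer frequencies over the square are \<open>p * k\<close> and
      \<open>p' * k\<close>; they do not both vanish as \<open>k\<close> is nonzero.\<close>
    with x D(2) have nz: "p * k \<noteq> 0 \<or> p' * k \<noteq> 0"
      using c(2) by auto
    have "c * of_int p * A = 2 * pi * of_int (p * k)" "c * of_int p' * A = 2 * pi * of_int (p' * k)"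
      using c(1) by (simp_all add: mult.commute mult.left_commute)
    note tail = uniform_phase_sum_tail[OF indep unif A this nz, of "t * (sqrt 3 / 2)" \<beta>]
    have eq: "- (t * (sqrt 3 / 2))\<^sup>2 / (2 * real CARD('n)) = - (3 * t\<^sup>2) / (8 * real CARD('n))"
      by (simp add: power_mult_distrib power_divide)
    have "0 \<le> t * (sqrt 3 / 2)" using t by simp
    from tail[OF this] show ?thesis
      unfolding xeq F_def prod.case eq .
  qed
  have finB: "finite B" "card B \<le> 3"
    unfolding B_def by (auto simp: card_insert_if)
  have "prob (\<Union>x\<in>D \<times> B. F x) \<le> (\<Sum>x\<in>D \<times> B. prob (F x))"
    using D(1) finB F by (intro measure_UNION_le) auto
  also have "\<dots> \<le> real (card (D \<times> B)) * exp (- (3 * t\<^sup>2) / (8 * real CARD('n)))"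
    by (rule sum_bounded_above) (rule prob_F)
  also have "real (card (D \<times> B)) \<le> 3 * real (card D)"
    using finB(2) unfolding card_cartesian_product of_nat_mult
    by (subst mult.commute) (intro mult_right_mono; simp)
  finally have "prob (\<Union>x\<in>D \<times> B. F x) \<le> 3 * real (card D) * exp (- (3 * t\<^sup>2) / (8 * real CARD('n)))"
    by (simp add: mult_right_mono)
  moreover have "(\<Union>x\<in>D \<times> B. F x) \<in> events"
    using D(1) finB F by (intro sets.finite_UN) auto
  ultimately have "E \<in> events" "prob E \<ge> 1 - 3 * real (card D) * exp (- (3 * t\<^sup>2) / (8 * real CARD('n)))"
    unfolding E_def by (auto simp: prob_compl)
  moreover have "norm (\<Sum>q\<in>UNIV. cis (c * of_int p * \<xi> q w + c * of_int p' * \<eta> q w)) < t"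
    if w: "w \<in> E" and p: "(p, p') \<in> D" for w p p'
  proof -
    have less: "(\<Sum>q\<in>UNIV. cos (c * of_int i * \<xi> q w + c * of_int i' * \<eta> q w + \<beta>)) < t * (sqrt 3 / 2)"
      if "(i, i') \<in> D" "\<beta> \<in> B" for i i' \<beta>
    proof -
      have "((i, i'), \<beta>) \<in> D \<times> B" using that by simp
      with w have "w \<notin> F ((i, i'), \<beta>)" "w \<in> space M"
        unfolding E_def by blast+
      then show ?thesis by (simp add: F_def not_le)
    qed
    show ?thesis
      using less[OF p] less[OF D(3)[OF p]]
      by (intro norm_sum_cis_less_if_three_directions) (simp_all add: B_def algebra_simps)
  qed
  ultimately show ?thesis by blast
qed

section \<open>Coherence of the sensing matrix\<close>

lemma sensing_matrix_unit_column:
  fixes a :: "'n::finite \<Rightarrow> real \<times> real \<times> real"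
  shows "hermitian_inner (column j (sensing_matrix \<omega> z0 r a)) (column j (sensing_matrix \<omega> z0 r a)) = 1"
proof -
  have "cnj (sensing_matrix \<omega> z0 r a $ q $ j) * sensing_matrix \<omega> z0 r a $ q $ j
      = of_real ((norm (sensing_matrix \<omega> z0 r a $ q $ j))\<^sup>2)" for q
    by (simp only: complex_norm_square mult.commute)
  moreover have "norm (sensing_matrix \<omega> z0 r a $ q $ j) = 1 / sqrt (real CARD('n))" for q
    by (simp add: sensing_matrix_def split_beta norm_mult norm_divide)
  ultimately have "cnj (sensing_matrix \<omega> z0 r a $ q $ j) * sensing_matrix \<omega> z0 r a $ q $ j
      = of_real (1 / real CARD('n))" for q
    by (simp add: power_divide)
  then show ?thesis
    by (simp add: hermitian_inner_def column_def)
qed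

lemma norm_sensing_matrix_inner_columns:
  fixes \<xi> \<eta> :: "'n::finite \<Rightarrow> real" and \<omega> z0 :: real
  assumes "r i = (x, y, u)" "r j = (x', y', u')"
  defines "\<Phi> \<equiv> sensing_matrix \<omega> z0 r (\<lambda>q. (\<xi> q, \<eta> q, 0))"
  shows "norm (hermitian_inner (column i \<Phi>) (column j \<Phi>)) =
    norm (\<Sum>q\<in>UNIV. cis (\<omega> / z0 * (x - x') * \<xi> q + \<omega> / z0 * (y - y') * \<eta> q)) / real CARD('n)"
proof -
  let ?n = "real CARD('n)"
  \<comment> \<open>The squares of the sensor coordinates cancel; \<open>\<theta>\<close> collects
    the terms independent of \<open>q\<close>, which contribute one common unimodular
    factor.\<close>
  define \<theta> where "\<theta> = \<omega> / (2 * z0) * (x'\<^sup>2 - x\<^sup>2 + y'\<^sup>2 - y\<^sup>2)"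
  have entry: "\<Phi> $ q $ k = of_real (1 / sqrt ?n) * cis (\<omega> / (2 * z0) * ((fst (r k) - \<xi> q)\<^sup>2 + (fst (snd (r k)) - \<eta> q)\<^sup>2))"
    for q k
    by (simp add: \<Phi>_def sensing_matrix_def split_beta cis_conv_exp)
  have "cnj (\<Phi> $ q $ i) * \<Phi> $ q $ j =
      of_real (1 / ?n) * cis \<theta> * cis (\<omega> / z0 * (x - x') * \<xi> q + \<omega> / z0 * (y - y') * \<eta> q)" for q
  proof -
    have "cnj (\<Phi> $ q $ i) * \<Phi> $ q $ j = of_real ((1 / sqrt ?n) * (1 / sqrt ?n)) *
        cis (- (\<omega> / (2 * z0) * ((x - \<xi> q)\<^sup>2 + (y - \<eta> q)\<^sup>2))
             + \<omega> / (2 * z0) * ((x' - \<xi> q)\<^sup>2 + (y' - \<eta> q)\<^sup>2))"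
      unfolding entry assms(1,2) complex_cnj_mult complex_cnj_complex_of_real cis_cnj of_real_mult
        cis_mult[symmetric]
      by (simp only: fst_conv snd_conv ac_simps)
    also have "- (\<omega> / (2 * z0) * ((x - \<xi> q)\<^sup>2 + (y - \<eta> q)\<^sup>2)) + \<omega> / (2 * z0) * ((x' - \<xi> q)\<^sup>2 + (y' - \<eta> q)\<^sup>2)
        = \<theta> + (\<omega> / z0 * (x - x') * \<xi> q + \<omega> / z0 * (y - y') * \<eta> q)"
    \<comment> \<open>For \<open>z0 = 0\<close> the quotients are \<open>0\<close> by convention and
      so are both sides.\<close>
    proof (cases "z0 = 0")
      case False
      then show ?thesis by (simp add: \<theta>_def field_simps power2_eq_square)
    qed (simp add: \<theta>_def)
    finally show ?thesis
      by (simp add: cis_mult[symmetric] mult.assoc)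
  qed
  then have "hermitian_inner (column i \<Phi>) (column j \<Phi>) = of_real (1 / ?n) * cis \<theta> *
      (\<Sum>q\<in>UNIV. cis (\<omega> / z0 * (x - x') * \<xi> q + \<omega> / z0 * (y - y') * \<eta> q))"
    by (simp add: hermitian_inner_def column_def sum_distrib_left)
  then show ?thesis
    by (simp add: norm_mult norm_divide)
qed

text \<open>The hypotheses force \<open>exp (K\<^sup>2 / 4) \<ge> 4\<close>. This pays for the six directions per lattice
  difference, and it is why the hexagon is used: the four half-planes \<open>\<bar>Re\<bar>, \<bar>Im\<bar> < t / sqrt 2\<close> leave
  no power of \<open>exp (K\<^sup>2)\<close> to spare.\<close>

lemma union_bound_less:
  fixes \<delta> K :: real
  assumes "\<delta> > 0" "\<delta> \<le> 1/2" "m \<ge> 4" "m \<le> \<delta> / 2 * exp (K\<^sup>2 / 2)"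
  shows "12 * m * exp (- (3 / 4 * K\<^sup>2)) < 2 * \<delta>"
proof -
  define u where "u = exp (K\<^sup>2 / 4)"
  have u: "exp (K\<^sup>2 / 2) = u\<^sup>2" "exp (- (3 / 4 * K\<^sup>2)) = 1 / u ^ 3" "u > 0"
    by (simp_all add: u_def exp_minus inverse_eq_divide flip: exp_of_nat_mult)
  have "m \<le> 1 / 4 * u\<^sup>2"
    using assms(4) mult_right_mono[OF assms(2), of "u\<^sup>2"] unfolding u(1) by simp
  then have "4\<^sup>2 \<le> u\<^sup>2" using assms(3) by simp
  then have u4: "4 \<le> u" using less_imp_le[OF u(3)] by (rule power2_le_imp_le)
  have "12 * m \<le> 6 * \<delta> * u\<^sup>2"
    using assms(4) unfolding u(1) by simp
  also have "\<dots> < 2 * \<delta> * u * u\<^sup>2"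
    using u4 assms(1) by simp
  also have "\<dots> = 2 * \<delta> * u ^ 3"
    by (simp add: power2_eq_square power3_eq_cube)
  finally show ?thesis
    using u(3) unfolding u(2) by (simp add: pos_divide_less_eq)
qed

section \<open>Lattice differences and the final probability bound\<close>

text \<open>\<open>E\<close> is a measurable event inside the success set, and a single sensor draw
  in \<open>E\<close> serves all \<open>X\<close> at once.\<close>

theorem mainTheorem4:
  fixes z0 l A lam \<omega> \<rho> \<delta> K :: real
    and N :: nat
    and r :: "'m::finite \<Rightarrow> real \<times> real \<times> real"
    and \<Omega> :: "'w measure"
    and \<xi> \<eta> :: "'n::finite \<Rightarrow> 'w \<Rightarrow> real"
  assumes pos: "z0 > 0" "l > 0" "A > 0" "lam > 0"
    and omega: "\<omega> = 2 * pi / lam"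
    and square: "CARD('m) = N\<^sup>2"
    and lattice: "square_lattice N l z0 r"
    and prob: "prob_space \<Omega>"
    and indep: "prob_space.indep_vars \<Omega> (\<lambda>_. borel) (\<lambda>q w. (\<xi> q w, \<eta> q w)) UNIV"
    and unif: "\<And>q. distr \<Omega> borel (\<lambda>w. (\<xi> q w, \<eta> q w)) =
                    uniform_measure lborel ({0..A} \<times> {0..A})"
    and rho: "\<rho> = lam * z0 / (l * A)"
    and rho_nat: "1 / \<rho> \<in> \<nat>"
    and delta_K: "\<delta> > 0" "K > 0"
    and m_le: "real CARD('m) \<le> \<delta> / 2 * exp (K\<^sup>2 / 2)"
  shows "\<exists>E \<in> sets \<Omega>.
    measure \<Omega> E > 1 - 2 * \<delta>
      - \<rho> * real CARD('n) * (real CARD('n) - 1) powr (3/2) / sqrt (real CARD('m)) \<and>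
    (\<forall>w\<in>E. \<forall>X :: complex ^ 'm.
      real (sparsity X) < 1/2 * (1 + sqrt (real CARD('n)) / (sqrt 2 * K)) \<longrightarrow>
      (let \<Phi> = sensing_matrix \<omega> z0 r (\<lambda>q. (\<xi> q w, \<eta> q w, 0))
       in bp_recovers \<Phi> X \<and> omp_recovers \<Phi> X))"
proof -
  interpret prob_space \<Omega> by (rule prob)
  let ?n = "real CARD('n)"
  have n: "?n > 0" by simp
  have "\<rho> > 0" using rho pos by simp
  then have extra: "0 \<le> \<rho> * ?n * (?n - 1) powr (3/2) / sqrt (real CARD('m))"
    by simp
  show ?thesis
  \<comment> \<open>For \<open>\<delta> > 1/2\<close> the claimed bound is negative and the empty
    event satisfies it.\<close>
  proof (cases "\<delta> > 1/2")
    case True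
    with extra show ?thesis by (intro bexI[of _ "{}"]) auto
  next
    case False
    have "N \<ge> 1" using square zero_less_card_finite[where 'a='m] by (cases N) auto
    obtain k where k: "1 / \<rho> = real k" using rho_nat by (auto elim: Nats_cases)
    have "k \<noteq> 0" using k \<open>\<rho> > 0\<close> by (cases k) auto
    \<comment> \<open>\<open>c\<close> is the phase frequency per mesh step;
      \<open>c * A = 2 * pi / \<rho>\<close>, so integrality of \<open>1 / \<rho>\<close> means full
      periods over the sensor square.\<close>
    define c where "c = \<omega> / z0 * l"
    have "c * A = 2 * pi * (1 / \<rho>)"
      using pos by (simp add: c_def omega rho field_simps)
    then have c: "c * A = 2 * pi * of_int (int k)" by (simp add: k)
    \<comment> \<open>\<open>t\<close> is \<open>CARD('n)\<close> times the desired coherence bound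
      \<open>\<mu>\<close>, which makes the exponent \<open>3 / 4 * K\<^sup>2\<close>.\<close>
    define t where "t = sqrt 2 * K * sqrt ?n"
    have t: "t \<ge> 0" using delta_K by (simp add: t_def)
    have "t\<^sup>2 = 2 * K\<^sup>2 * ?n" by (simp add: t_def power_mult_distrib)
    then have expo: "- (3 * t\<^sup>2) / (8 * ?n) = - (3 / 4 * K\<^sup>2)"
      using n by (simp add: field_simps)
    define I where "I = {- (int N - 1)..int N - 1}"
    define D where "D = I \<times> I - {(0, 0)}"
    have D: "finite D" "(0, 0) \<notin> D" "\<And>p p'. (p, p') \<in> D \<Longrightarrow> (- p, - p') \<in> D"
      by (auto simp: D_def I_def)
    obtain E where E: "E \<in> events" "prob E \<ge> 1 - 3 * real (card D) * exp (- (3 / 4 * K\<^sup>2))"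
      and small: "\<And>w p p'. w \<in> E \<Longrightarrow> (p, p') \<in> D \<Longrightarrow>
        norm (\<Sum>q\<in>UNIV. cis (c * of_int p * \<xi> q w + c * of_int p' * \<eta> q w)) < t"
      using uniform_phase_sums_bounded[OF indep unif pos(3) c _ t D] \<open>k \<noteq> 0\<close>
      unfolding expo by fastforce
    have "3 * real (card D) * exp (- (3 / 4 * K\<^sup>2)) < 2 * \<delta>"
    \<comment> \<open>A single grid point leaves no differences; otherwise \<open>m\<close> is at
      least 4 and \<open>card D \<le> (2 * N)\<^sup>2 = 4 * m\<close>.\<close>
    proof (cases "N = 1")
      case True
      then have "D = {}" by (auto simp: D_def I_def)
      then show ?thesis using delta_K by simp
    next
      case False
      with \<open>N \<ge> 1\<close> have "N \<ge> 2" by simp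
      then have m4: "real CARD('m) \<ge> 4"
        unfolding square using power_mono[of 2 "real N" 2] by simp
      have "card D \<le> card (I \<times> I)" by (intro card_mono) (auto simp: D_def I_def)
      also have "\<dots> \<le> (2 * N) * (2 * N)"
        unfolding card_cartesian_product by (intro mult_mono) (auto simp: I_def)
      finally have "real (card D) \<le> 4 * real CARD('m)"
        using of_nat_mono[of "card D" "2 * N * (2 * N)", where 'a=real]
        by (simp add: square power2_eq_square)
      then have "3 * real (card D) * exp (- (3 / 4 * K\<^sup>2)) \<le> 12 * real CARD('m) * exp (- (3 / 4 * K\<^sup>2))"
        by simp
      also have "\<dots> < 2 * \<delta>"
        using \<open>\<not> \<delta> > 1/2\<close> by (intro union_bound_less delta_K m4 m_le) auto
      finally show ?thesis .
    qed
    with E(2) extra have "prob E > 1 - 2 * \<delta> - \<rho> * ?n * (?n - 1) powr (3/2) / sqrt (real CARD('m))"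
      by linarith
    moreover have "let \<Phi> = sensing_matrix \<omega> z0 r (\<lambda>q. (\<xi> q w, \<eta> q w, 0))
       in bp_recovers \<Phi> X \<and> omp_recovers \<Phi> X"
      if w: "w \<in> E" and s: "real (sparsity X) < 1/2 * (1 + sqrt ?n / (sqrt 2 * K))"
      for w and X :: "complex ^ 'm"
    proof -
      define \<Phi> where "\<Phi> = sensing_matrix \<omega> z0 r (\<lambda>q. (\<xi> q w, \<eta> q w, 0))"
      define \<mu> where "\<mu> = sqrt 2 * K / sqrt ?n"
      have t_mu: "t / ?n = \<mu>"
        using n by (simp add: t_def \<mu>_def divide_simps)
      interpret incoherent \<Phi> \<mu>
      proof
        show "\<mu> > 0" using delta_K by (simp add: \<mu>_def)
        show "hermitian_inner (column j \<Phi>) (column j \<Phi>) = 1" for j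
          unfolding \<Phi>_def by (rule sensing_matrix_unit_column)
        show "norm (hermitian_inner (column i \<Phi>) (column j \<Phi>)) \<le> \<mu>" if "i \<noteq> j" for i j
        proof -
          obtain x0 y0 where bij: "bij_betw r UNIV {(x0 + real a * l, y0 + real b * l, z0) |a b. a < N \<and> b < N}"
            using lattice unfolding square_lattice_def by blast
          have "\<exists>a b. r i' = (x0 + real a * l, y0 + real b * l, z0) \<and> a < N \<and> b < N" for i'
            using bij_betwE[OF bij] by blast
          then obtain a b a' b' where
            ri: "r i = (x0 + real a * l, y0 + real b * l, z0)" "a < N" "b < N" and
            rj: "r j = (x0 + real a' * l, y0 + real b' * l, z0)" "a' < N" "b' < N"
            by metis
          \<comment> \<open>Distinct indices enumerate distinct grid points, so their difference is
            not the excluded pair \<open>(0, 0)\<close>.\<close>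
          have "r i \<noteq> r j"
            using bij \<open>i \<noteq> j\<close> by (auto simp: bij_betw_def inj_on_def)
          with ri rj have "(int a - int a', int b - int b') \<in> D"
            by (auto simp: D_def I_def)
          moreover have "(x0 + real d * l) - (x0 + real d' * l) = l * of_int (int d - int d')" for x0 :: real and d d'
            by (simp add: algebra_simps)
          then have "\<omega> / z0 * ((x0 + real a * l) - (x0 + real a' * l)) = c * of_int (int a - int a')"
            "\<omega> / z0 * ((y0 + real b * l) - (y0 + real b' * l)) = c * of_int (int b - int b')"
            by (simp_all only: c_def mult.assoc)
          ultimately have "norm (\<Sum>q\<in>UNIV. cis (\<omega> / z0 * ((x0 + real a * l) - (x0 + real a' * l)) * \<xi> q w
              + \<omega> / z0 * ((y0 + real b * l) - (y0 + real b' * l)) * \<eta> q w)) < t"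
            using small[OF w] by (simp only:)
          then have "norm (hermitian_inner (column i \<Phi>) (column j \<Phi>)) \<le> t / ?n"
            unfolding \<Phi>_def norm_sensing_matrix_inner_columns[OF ri(1) rj(1)]
            by (intro divide_right_mono) auto
          then show ?thesis by (simp only: t_mu)
        qed
      qed
      \<comment> \<open>The sparsity threshold is exactly
        \<open>(1 + 1 / \<mu>) / 2\<close>.\<close>
      have "2 * real (sparsity X) - 1 < 1 / \<mu>"
        using s by (simp add: \<mu>_def)
      then have "(2 * real (sparsity X) - 1) * \<mu> < 1"
        using mu_pos by (simp add: pos_less_divide_eq)
      then show ?thesis
        unfolding Let_def \<Phi>_def[symmetric]
        using bp_recovers_sparse omp_recovers_sparse by blast
    qed
    ultimately show ?thesis
      using E(1) by (intro bexI[of _ E] conjI) auto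
  qed
qed

end
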